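(* Let $(T,d,\rho)$ be a compact rooted real tree. Let $a\in(0,\infty)$ be such that the $a$-level set $T(a)$ is not empty. Let $\mu$ be a finite Borel measure on $T$ such that $\mu(T\setminus T(a))=0$. Let $A\subset T(a)$ be a Borel subset and let $c\in(0,\infty)$. Assume that $$\forall\sigma\in A,\qquad\limsup_{r\to0}\frac{\mu(B(\sigma,r))}{g(r)}>c.$$ Then $\mu(A)\ge c\,\mathscr H_g(A)$.
   Context: A metric space $(T,d)$ is a real tree if for all $\sigma_1,\sigma_2\in T$: there is a unique isometric map $f$ from $[0,d(\sigma_1,\sigma_2)]$ into $T$ with $f(0)=\sigma_1$, $f(d(\sigma_1,\sigma_2))=\sigma_2$; and every continuous injective path from $\sigma_1$ to $\sigma_2$ has the same image as $f$. A rooted real tree has a distinguished point $\rho$; $T(a)=\{\sigma\in T:d(\rho,\sigma)=a\}$; $B(\sigma,r)$ is the open ball of $T$ with center $\sigma$ and radius $r$. Here $r_0\in(0,\infty)$ and $g:[0,r_0)\to[0,\infty)$ is an increasing continuous function with $g(0)=0$. For $\varepsilon\in(0,r_0)$ and $A\subset T$, $\mathscr H_g^{(\varepsilon)}(A)=\inf\{\sum_{n\in\mathbb N}g(\mathrm{diam}(E_n)):A\subset\bigcup_nE_n,\ \mathrm{diam}(E_n)<\varepsilon\}$, and $\mathscr H_g(A)=\lim_{\varepsilon\downarrow0}\mathscr H_g^{(\varepsilon)}(A)$ is the $g$-Hausdorff measure on $T$. *)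

theory Defs
  imports "HOL-Analysis.Analysis"
begin

definition geodesic :: "(real \<Rightarrow> 'a::metric_space) \<Rightarrow> 'a \<Rightarrow> 'a \<Rightarrow> bool" where
  "geodesic f x y \<longleftrightarrow>
     f 0 = x \<and> f (dist x y) = y \<and>
     (\<forall>s\<in>{0..dist x y}. \<forall>t\<in>{0..dist x y}. dist (f s) (f t) = dist s t)"

text \<open>Maps defined on $[0, d(x,y)]$ are represented by total functions on the reals, so the
  uniqueness of the geodesic only concerns its values on that interval.\<close>

class real_tree = metric_space +
  assumes unique_geodesic:
    "\<exists>f. geodesic f x y \<and>
         (\<forall>h. geodesic h x y \<longrightarrow> (\<forall>t\<in>{0..dist x y}. h t = f t))"
  and arc_image_eq_geodesic:
    "geodesic f x y \<Longrightarrow> arc p \<Longrightarrow> pathstart p = x \<Longrightarrow> pathfinish p = y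
       \<Longrightarrow> path_image p = f ` {0..dist x y}"

abbreviation level_set :: "'a::metric_space \<Rightarrow> real \<Rightarrow> 'a set" where
  "level_set \<rho> a \<equiv> {\<sigma>. dist \<rho> \<sigma> = a}"

text \<open>The library's \<^const>\<open>diameter\<close> is real-valued and carries no information on unbounded
  sets, hence the explicit boundedness condition (an unbounded set has diameter \<open>\<infinity>\<close>, which is
  not below \<open>\<epsilon>\<close>). The empty set has diameter \<open>0\<close>, so finite covers are included
  when \<open>g 0 = 0\<close>.\<close>

definition hausdorff_pre :: "(real \<Rightarrow> real) \<Rightarrow> real \<Rightarrow> 'a::metric_space set \<Rightarrow> ennreal" where
  "hausdorff_pre g \<epsilon> A =
     (INF E \<in> {E :: nat \<Rightarrow> 'a set. A \<subseteq> (\<Union>n. E n) \<and> (\<forall>n. bounded (E n) \<and> diameter (E n) < \<epsilon>)}.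
        \<Sum>n. ennreal (g (diameter (E n))))"

definition hausdorff_measure :: "(real \<Rightarrow> real) \<Rightarrow> 'a::metric_space set \<Rightarrow> ennreal" where
  "hausdorff_measure g A = Lim (at_right 0) (\<lambda>\<epsilon>. hausdorff_pre g \<epsilon> A)"

lemma hausdorff_pre_antimono:
  assumes "\<epsilon> \<le> \<epsilon>'"
  shows "hausdorff_pre g \<epsilon>' A \<le> hausdorff_pre g \<epsilon> A"
  unfolding hausdorff_pre_def
  by (rule INF_superset_mono) (use assms in \<open>auto intro: less_le_trans\<close>)

text \<open>The limit defining \<^const>\<open>hausdorff_measure\<close> always exists.\<close>

lemma hausdorff_pre_tendsto:
  "((\<lambda>\<epsilon>. hausdorff_pre g \<epsilon> A) \<longlongrightarrow> (SUP \<epsilon>\<in>{0<..}. hausdorff_pre g \<epsilon> A)) (at_right 0)"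
proof (rule order_tendstoI)
  fix y assume "y < (SUP \<epsilon>\<in>{0<..}. hausdorff_pre g \<epsilon> A)"
  then obtain e where e: "e > 0" "y < hausdorff_pre g e A"
    by (auto simp: less_SUP_iff)
  show "\<forall>\<^sub>F \<epsilon> in at_right 0. y < hausdorff_pre g \<epsilon> A"
    unfolding eventually_at_right_field
    using e less_le_trans[OF e(2) hausdorff_pre_antimono] by (meson less_imp_le)
next
  fix y assume y: "(SUP \<epsilon>\<in>{0<..}. hausdorff_pre g \<epsilon> A) < y"
  have "\<forall>\<^sub>F \<epsilon> in at_right (0::real). 0 < \<epsilon>"
    by (rule eventually_at_right_less)
  then show "\<forall>\<^sub>F \<epsilon> in at_right 0. hausdorff_pre g \<epsilon> A < y"
    by eventually_elim (rule le_less_trans[OF SUP_upper y], simp)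
qed

lemma hausdorff_measure_eq_SUP:
  "hausdorff_measure g A = (SUP \<epsilon>\<in>{0<..}. hausdorff_pre g \<epsilon> A)"
  unfolding hausdorff_measure_def
  by (rule tendsto_Lim[OF _ hausdorff_pre_tendsto]) simp

end

theory Submission imports Defs begin

text \<open>Two points of \<open>T(a)\<close> are at distance \<open>2 (a - m)\<close>, where \<open>m\<close> is the height at which their
  geodesics from the root separate, so \<open>T(a)\<close> is ultrametric. Given an open \<open>U\<close> containing \<open>A\<close>,
  the density hypothesis covers \<open>A\<close> by small balls \<open>B(\<sigma>, r) \<inter> T(a)\<close> inside \<open>U\<close> with
  \<open>\<mu>(B(\<sigma>, r)) \<ge> c g(r)\<close>. Being ultrametric balls they can be chosen pairwise disjoint, with diameter
  at most \<open>r\<close> and no constant lost; summing gives \<open>c H(A) \<le> \<mu>(U)\<close>, and outer regularity concludes.\<close>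

section \<open>Outer regularity of finite Borel measures on a metric space\<close>

text \<open>Sets squeezed between a closed and an open set whose difference has arbitrarily small
  measure form a sigma-algebra containing the open sets. Approximation from both sides is carried
  through the induction because complementation exchanges the two.\<close>

lemma outer_regular_metric:
  fixes M :: "'a::metric_space measure"
  assumes "finite_measure M" and M: "sets M = sets borel" and "B \<in> sets borel" and "0 < e"
  obtains U where "open U" "B \<subseteq> U" "measure M U < measure M B + e"
proof -
  interpret finite_measure M by fact
  have borM: "X \<in> sets M" if "X \<in> sets borel" for X using that M by simp
  define P where "P B \<longleftrightarrow> (\<forall>e>0. \<exists>U F. open U \<and> closed F \<and> F \<subseteq> B \<and> B \<subseteq> U \<and> measure M (U - F) < e)" for B
  have "B \<in> sigma_sets UNIV {S. open S}" using assms by (simp add: sets_borel)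
  then have "P B"
  proof induction
    case (Basic S)
    then have S: "open S" by simp
    \<comment> \<open>These closed sets increase to \<open>S\<close>, since a point of an open set
      has positive distance to the complement.\<close>
    define F where "F n = {x. infdist x (- S) \<ge> 1 / real (Suc n)}" for n
    show ?case unfolding P_def
    proof (intro allI impI)
      fix e :: real assume "e > 0"
      show "\<exists>U F. open U \<and> closed F \<and> F \<subseteq> S \<and> S \<subseteq> U \<and> measure M (U - F) < e"
      \<comment> \<open>The whole space is separate because \<open>infdist\<close> to the empty set
        is 0 by convention, which would make every \<open>F n\<close> empty.\<close>
      proof (cases "S = UNIV")
        case True
        then show ?thesis using \<open>e > 0\<close> by (intro exI[of _ UNIV]) auto
      next
        case False
        have clF: "closed (F n)" for n
          unfolding F_def by (intro closed_Collect_le continuous_intros)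
        have inS: "x \<in> S \<longleftrightarrow> infdist x (-S) > 0" for x
          using in_closed_iff_infdist_zero[of "-S" x] S False infdist_nonneg[of x "-S"]
          by fastforce
        have FS: "F n \<subseteq> S" for n
        proof
          fix x assume "x \<in> F n"
          then have "1 / real (Suc n) \<le> infdist x (-S)" by (simp add: F_def)
          then have "0 < infdist x (-S)" by (rule less_le_trans[rotated]) simp
          then show "x \<in> S" by (simp add: inS)
        qed
        have Un: "(\<Union>n. F n) = S"
        proof
          show "S \<subseteq> (\<Union>n. F n)"
          proof
            fix x assume "x \<in> S"
            then obtain n where "1 / real (Suc n) < infdist x (-S)"
              using nat_approx_posE inS by blast
            then show "x \<in> (\<Union>n. F n)" by (auto simp: F_def intro!: exI[of _ n])
          qed
        qed (use FS in auto)
        have "(\<lambda>n. measure M (F n)) \<longlonglongrightarrow> measure M (\<Union>n. F n)"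
        proof (rule finite_Lim_measure_incseq)
          show "range F \<subseteq> sets M" using clF borM by auto
          show "incseq F"
          proof (rule incseq_SucI)
            fix n
            have "1 / real (Suc (Suc n)) \<le> 1 / real (Suc n)" by (simp add: frac_le)
            then show "F n \<subseteq> F (Suc n)" unfolding F_def by (auto simp del: of_nat_Suc)
          qed
        qed
        then have "\<forall>\<^sub>F n in sequentially. measure M S - e < measure M (F n)"
          unfolding Un by (rule order_tendstoD) (use \<open>e > 0\<close> in simp)
        then obtain n where "measure M S - e < measure M (F n)"
          by (meson eventually_False_sequentially eventually_mono sequentially_bot)
        then have "measure M (S - F n) < e"
          using finite_measure_Diff[of S "F n"] borM S clF[of n] FS[of n] by auto
        then show ?thesis using S clF FS by blast
      qed
    qed
  next
    case Empty
    show ?case unfolding P_def by (auto intro!: exI[of _ "{}"])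
  next
    case (Compl B)
    show ?case unfolding P_def
    proof (intro allI impI)
      fix e :: real assume "e > 0"
      then have "\<exists>U F. open U \<and> closed F \<and> F \<subseteq> B \<and> B \<subseteq> U \<and> measure M (U - F) < e"
        using Compl.IH unfolding P_def by simp
      then obtain U F where "open U" "closed F" "F \<subseteq> B" "B \<subseteq> U" "measure M (U - F) < e"
        by blast
      moreover have "- F - - U = U - F" by auto
      ultimately have "open (- F) \<and> closed (- U) \<and> - U \<subseteq> UNIV - B \<and> UNIV - B \<subseteq> - F
          \<and> measure M (- F - - U) < e"
        by (auto simp: open_Compl closed_Compl)
      then show "\<exists>U F. open U \<and> closed F \<and> F \<subseteq> UNIV - B \<and> UNIV - B \<subseteq> U \<and> measure M (U - F) < e"
        by blast
    qed
  next
    case (Union B)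
    show ?case unfolding P_def
    proof (intro allI impI)
      fix e :: real assume "e > 0"
      \<comment> \<open>The errors sum to \<open>e/2\<close>; the other half restores the strict
        inequality after comparing series.\<close>
      have "\<forall>n. \<exists>U F. open U \<and> closed F \<and> F \<subseteq> B n \<and> B n \<subseteq> U \<and> measure M (U - F) < e/2 * (1/2)^Suc n"
      proof
        fix n
        have "0 < e/2 * (1/2)^Suc n" using \<open>e > 0\<close> by simp
        then show "\<exists>U F. open U \<and> closed F \<and> F \<subseteq> B n \<and> B n \<subseteq> U \<and> measure M (U - F) < e/2 * (1/2)^Suc n"
          using Union.IH[of n, unfolded P_def, rule_format] by blast
      qed
      then obtain U F where UF: "\<And>n. open (U n)" "\<And>n. closed (F n)" "\<And>n. F n \<subseteq> B n" "\<And>n. B n \<subseteq> U n"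
          "\<And>n. measure M (U n - F n) < e/2 * (1/2)^Suc n"
        by metis
      have [simp]: "U n \<in> sets M" "F n \<in> sets M" for n using UF borM by auto
      have sums: "(\<lambda>n. e/2 * (1/2)^Suc n) sums (e/2)"
        using sums_mult[OF power_half_series, of "e/2"] by simp
      have summ: "summable (\<lambda>n. measure M (U n - F n))"
        by (rule summable_comparison_test'[OF sums_summable[OF sums], of 0])
           (use UF(5) in \<open>auto intro: less_imp_le\<close>)
      have "measure M ((\<Union>n. U n) - (\<Union>n. F n)) \<le> measure M (\<Union>n. U n - F n)"
        by (rule finite_measure_mono) (auto intro!: sets.countable_UN)
      also have "\<dots> \<le> (\<Sum>n. measure M (U n - F n))"
        by (rule finite_measure_subadditive_countably[OF _ summ]) auto
      also have "\<dots> \<le> e/2"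
        using suminf_le[OF less_imp_le[OF UF(5)] summ sums_summable[OF sums]] sums_unique[OF sums]
        by simp
      also have "\<dots> < e" using \<open>e > 0\<close> by simp
      finally have 1: "measure M ((\<Union>n. U n) - (\<Union>n. F n)) < e" .
      \<comment> \<open>The union of all \<open>F n\<close> may fail to be closed. Finite unions are
        closed, and continuity from above shows that one of them already leaves a gap below
        \<open>e\<close>.\<close>
      define G where "G N = (\<Union>n\<in>{..N}. F n)" for N
      have Gcl: "closed (G N)" for N unfolding G_def using UF by auto
      have "(\<lambda>N. measure M ((\<Union>n. U n) - G N)) \<longlonglongrightarrow> measure M (\<Inter>N. (\<Union>n. U n) - G N)"
      proof (rule finite_Lim_measure_decseq)
        show "range (\<lambda>N. (\<Union>n. U n) - G N) \<subseteq> sets M" 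
          using borM[OF borel_closed[OF Gcl]] by (auto intro!: sets.countable_UN)
        show "decseq (\<lambda>N. (\<Union>n. U n) - G N)"
          by (rule decseq_SucI) (auto simp: G_def)
      qed
      also have "(\<Inter>N. (\<Union>n. U n) - G N) = (\<Union>n. U n) - (\<Union>n. F n)"
        by (auto simp: G_def)
      finally have "\<forall>\<^sub>F N in sequentially. measure M ((\<Union>n. U n) - G N) < e"
        using 1 by (rule order_tendstoD(2))
      then obtain N where "measure M ((\<Union>n. U n) - G N) < e"
        by (meson eventually_False_sequentially eventually_mono sequentially_bot)
      moreover have "G N \<subseteq> (\<Union>n. B n)" "(\<Union>n. B n) \<subseteq> (\<Union>n. U n)" "open (\<Union>n. U n)"
        unfolding G_def using UF(1,3,4) by blast+
      ultimately show "\<exists>U F. open U \<and> closed F \<and> F \<subseteq> \<Union> (range B) \<and> \<Union> (range B) \<subseteq> U \<and> measure M (U - F) < e"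
        using Gcl by blast
    qed
  qed
  then have "\<exists>U F. open U \<and> closed F \<and> F \<subseteq> B \<and> B \<subseteq> U \<and> measure M (U - F) < e"
    using \<open>0 < e\<close> unfolding P_def by simp
  then obtain U F where UF: "open U" "closed F" "F \<subseteq> B" "B \<subseteq> U" "measure M (U - F) < e"
    by blast
  have [simp]: "U \<in> sets M" "F \<in> sets M" "B \<in> sets M" using UF borM assms by auto
  have "measure M U = measure M F + measure M (U - F)"
    using finite_measure_Diff[of U F] UF by auto
  moreover have "measure M F \<le> measure M B" by (rule finite_measure_mono) (use UF in auto)
  ultimately show thesis using UF that by fastforce
qed

section \<open>Countability of disjoint families of balls\<close>

text \<open>A compact set has a countable dense subset, the union of finite nets of mesh
  \<open>1 / Suc n\<close>. Each ball contains one of its points, and disjointness makes this choice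
  injective.\<close>

lemma countable_disjoint_balls_compact:
  fixes L :: "'a::metric_space set"
  assumes L: "compact L" and A: "A \<subseteq> L" and R: "\<And>x. x \<in> A \<Longrightarrow> 0 < R x"
    and disj: "disjoint ((\<lambda>x. ball x (R x) \<inter> L) ` A)"
  shows "countable ((\<lambda>x. ball x (R x) \<inter> L) ` A)" (is "countable ?D")
proof -
  have "\<exists>K\<subseteq>L. finite K \<and> L \<subseteq> (\<Union>x\<in>K. ball x (1 / real (Suc n)))" for n
    by (rule compactE_image[OF L, of L "\<lambda>x. ball x (1 / real (Suc n))"]) auto
  then obtain K where K: "\<And>n. K n \<subseteq> L" "\<And>n. finite (K n)"
      "\<And>n. L \<subseteq> (\<Union>x\<in>K n. ball x (1 / real (Suc n)))"
    by metis
  have "\<exists>k \<in> \<Union>n. K n. k \<in> S" if "S \<in> ?D" for S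
  proof -
    from that obtain x where x: "x \<in> A" "S = ball x (R x) \<inter> L" by auto
    obtain n where n: "1 / real (Suc n) < R x" using nat_approx_posE R[OF x(1)] by blast
    obtain k where "k \<in> K n" "dist k x < 1 / real (Suc n)" using K(3)[of n] x(1) A by auto
    then show ?thesis using K(1)[of n] n x by (auto simp: dist_commute intro!: bexI[of _ k])
  qed
  then obtain k where k: "\<And>S. S \<in> ?D \<Longrightarrow> k S \<in> (\<Union>n. K n)" "\<And>S. S \<in> ?D \<Longrightarrow> k S \<in> S"
    by metis
  have "inj_on k ?D"
  proof (rule inj_onI)
    fix S T assume ST: "S \<in> ?D" "T \<in> ?D" "k S = k T"
    then have "S \<inter> T \<noteq> {}" using k(2)[of S] k(2)[of T] by auto
    then show "S = T" using disj ST(1,2) disjointD by blast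
  qed
  moreover have "countable (k ` ?D)"
  proof (rule countable_subset)
    show "k ` ?D \<subseteq> (\<Union>n. K n)" using k(1) by blast
    show "countable (\<Union>n. K n)" by (rule countable_UN) (auto intro: countable_finite K(2))
  qed
  ultimately show ?thesis using countable_image_inj_on by blast
qed

section \<open>Geodesics from the root and the ultrametric on a level set\<close>

lemma geodesic_initial_segment:
  assumes "geodesic f x y" "t \<in> {0..dist x y}"
  shows "dist x (f t) = t" "geodesic f x (f t)"
proof -
  show *: "dist x (f t) = t" using assms unfolding geodesic_def
    by (metis abs_of_nonneg atLeastAtMost_iff cancel_comm_monoid_add_class.diff_zero dist_commute
        dist_real_def order_refl zero_le_dist)
  show "geodesic f x (f t)" using assms unfolding geodesic_def * by auto
qed

text \<open>Cut at \<open>t\<close>, both maps are geodesics from \<open>x\<close> to the same point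
  \<open>f t = h t\<close>, so uniqueness applies.\<close>

lemma geodesics_agree_below:
  fixes x :: "'a::real_tree"
  assumes f: "geodesic f x y" and h: "geodesic h x z"
    and t: "t \<le> dist x y" "t \<le> dist x z" and eq: "f t = h t" and s: "0 \<le> s" "s \<le> t"
  shows "f s = h s"
proof -
  have t0: "t \<in> {0..dist x y}" "t \<in> {0..dist x z}" using t s by auto
  note f' = geodesic_initial_segment[OF f t0(1)] and h' = geodesic_initial_segment[OF h t0(2)]
  obtain k where k: "\<And>g. geodesic g x (f t) \<Longrightarrow> \<forall>s\<in>{0..dist x (f t)}. g s = k s"
    using unique_geodesic[of x "f t"] by blast
  have "s \<in> {0..dist x (f t)}" using s f'(1) by simp
  then show ?thesis using k[OF f'(2)] k[OF h'(2)[folded eq]] by metis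
qed

lemma geodesic_continuous_on: "geodesic f x y \<Longrightarrow> continuous_on {0..dist x y} f"
proof (unfold continuous_on_iff, intro ballI allI impI)
  fix s e :: real assume "geodesic f x y" "s \<in> {0..dist x y}" "0 < e"
  then show "\<exists>d>0. \<forall>t\<in>{0..dist x y}. dist t s < d \<longrightarrow> dist (f t) (f s) < e"
    unfolding geodesic_def by (intro exI[of _ e]) simp
qed

lemma geodesic_final_segment:
  assumes f: "geodesic f x y" and t: "t \<in> {0..dist x y}"
  shows "dist (f t) y = dist x y - t"
proof -
  have "dist (f t) (f (dist x y)) = dist t (dist x y)"
    using f t unfolding geodesic_def by (metis atLeastAtMost_iff order_refl zero_le_dist)
  then show ?thesis using f t unfolding geodesic_def by (simp add: dist_real_def)
qed

lemma geodesic_dist_add: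
  assumes h: "geodesic h x y" and w: "w \<in> h ` {0..dist x y}"
  shows "dist x w + dist w y = dist x y"
proof -
  obtain t where t: "w = h t" "t \<in> {0..dist x y}" using w by auto
  then show ?thesis using geodesic_initial_segment(1)[OF h t(2)] geodesic_final_segment[OF h t(2)]
    by simp
qed

text \<open>Two geodesics from the root that end at the same height \<open>a\<close> separate at a height \<open>m\<close>.
  The path going down the first one to height \<open>m\<close> and then up the second one is an arc, hence its
  image is that of a geodesic.\<close>

lemma real_tree_branch_height:
  fixes \<rho> :: "'a::real_tree"
  assumes f: "geodesic f \<rho> x" and h: "geodesic h \<rho> y" and x: "dist \<rho> x = a" and y: "dist \<rho> y = a"
  obtains m where "0 \<le> m" "m \<le> a" "f m = h m" "dist x y = 2 * (a - m)"
proof (cases "x = y")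
  case True
  then show ?thesis using that[of a] x y f h zero_le_dist[of \<rho> x] by (auto simp: geodesic_def)
next
  case False
  have a0: "0 \<le> a" using x zero_le_dist by metis
  note cf = geodesic_continuous_on[OF f, unfolded x] and ch = geodesic_continuous_on[OF h, unfolded y]
  have f0: "f 0 = \<rho>" "f a = x" and h0: "h 0 = \<rho>" "h a = y" using f h x y by (auto simp: geodesic_def)
  have df: "dist \<rho> (f t) = t" if "0 \<le> t" "t \<le> a" for t
    using geodesic_initial_segment(1)[OF f] that x by auto
  have dh: "dist \<rho> (h t) = t" if "0 \<le> t" "t \<le> a" for t
    using geodesic_initial_segment(1)[OF h] that y by auto
  \<comment> \<open>The heights at which the two geodesics agree. As the zero set of a continuous
    function on a compact interval, \<open>S\<close> is closed and contains its supremum, the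
    separation height \<open>m\<close>.\<close>
  define S where "S = {t\<in>{0..a}. dist (f t) (h t) = 0}"
  have "continuous_on {0..a} (\<lambda>t. dist (f t) (h t))" by (intro continuous_intros cf ch)
  then have "closed S"
    using continuous_closed_preimage[of "{0..a}" "\<lambda>t. dist (f t) (h t)" "{0}"]
    unfolding S_def vimage_def Int_def by simp
  moreover have "S \<noteq> {}" using a0 f0 h0 by (auto simp: S_def intro!: exI[of _ 0])
  moreover have bdd: "bdd_above S" by (rule bdd_aboveI[of _ a]) (auto simp: S_def)
  ultimately have "Sup S \<in> S" by (simp add: closed_contains_Sup)
  define m where "m = Sup S"
  have m: "0 \<le> m" "m \<le> a" "f m = h m" using \<open>Sup S \<in> S\<close> by (auto simp: m_def S_def)
  have mmax: "t \<le> m" if "0 \<le> t" "t \<le> a" "f t = h t" for t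
    unfolding m_def by (rule cSup_upper[OF _ bdd]) (use that in \<open>auto simp: S_def\<close>)
  have ma: "m < a" using m False f0 h0 by (cases "m = a") auto
  have scale: "0 \<le> m + t * (a - m)" "m + t * (a - m) \<le> a" "m \<le> m + t * (a - m)"
    if "t \<in> {0..1}" for t
  proof -
    have "0 \<le> t * (a - m)" "t * (a - m) \<le> 1 * (a - m)"
      using that ma by (auto intro: mult_right_mono)
    with m(1) show "0 \<le> m + t * (a - m)" "m + t * (a - m) \<le> a" "m \<le> m + t * (a - m)"
      by simp_all
  qed
  \<comment> \<open>Injectivity comes from the root: the distance to \<rho> recovers the height,
    hence the parameter.\<close>
  have arc_f: "arc (\<lambda>t. k (m + t * (a - m)))"
    if ck: "continuous_on {0..a} k" and dk: "\<And>t. 0 \<le> t \<Longrightarrow> t \<le> a \<Longrightarrow> dist \<rho> (k t) = t" for k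
    unfolding arc_def
  proof
    show "path (\<lambda>t. k (m + t * (a - m)))" unfolding path_def
      by (rule continuous_on_compose2[OF ck]) (use scale in \<open>auto intro!: continuous_intros\<close>)
    show "inj_on (\<lambda>t. k (m + t * (a - m))) {0..1}"
    proof (rule inj_onI)
      fix s t :: real assume st: "s \<in> {0..1}" "t \<in> {0..1}" "k (m + s * (a - m)) = k (m + t * (a - m))"
      then have "m + s * (a - m) = m + t * (a - m)" using dk scale by metis
      then show "s = t" using ma by simp
    qed
  qed
  define p q where "p = (\<lambda>t. f (m + t * (a - m)))" and "q = (\<lambda>t. h (m + t * (a - m)))"
  have p: "arc p" "pathstart p = f m" "pathfinish p = x"
    unfolding p_def using arc_f[OF cf df] f0 by (auto simp: pathstart_def pathfinish_def)
  have q: "arc q" "pathstart q = f m" "pathfinish q = y"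
    unfolding q_def using arc_f[OF ch dh] h0 m by (auto simp: pathstart_def pathfinish_def)
  \<comment> \<open>A common point has only one height, so both geodesics pass through it at that
    height, which by maximality cannot exceed \<open>m\<close>.\<close>
  have "path_image p \<inter> path_image q \<subseteq> {f m}"
  proof
    fix w assume "w \<in> path_image p \<inter> path_image q"
    then obtain s t where st: "s \<in> {0..1}" "t \<in> {0..1}" "w = f (m + s * (a - m))" "w = h (m + t * (a - m))"
      by (auto simp: path_image_def p_def q_def)
    then have eq: "m + s * (a - m) = m + t * (a - m)" using df dh scale by metis
    then have "m + s * (a - m) \<le> m" using mmax[of "m + s * (a - m)"] scale[OF st(1)] st by metis
    then have "m + s * (a - m) = m" using scale(3)[OF st(1)] by linarith
    then show "w \<in> {f m}" using st(3) by (metis singletonI)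
  qed
  then have arc: "arc (reversepath p +++ q)"
    by (intro arc_join) (use p q in \<open>auto simp: arc_reversepath\<close>)
  obtain k where k: "geodesic k x y" using unique_geodesic[of x y] by blast
  have "path_image (reversepath p +++ q) = k ` {0..dist x y}"
    by (rule arc_image_eq_geodesic[OF k arc]) (use p q in auto)
  \<comment> \<open>The branch point lies on the arc, hence on the geodesic from \<open>x\<close> to
    \<open>y\<close>, so distances add up through it.\<close>
  moreover have "f m \<in> path_image (reversepath p +++ q)"
    using p q pathstart_in_path_image[of p] by (simp add: path_image_join)
  ultimately have "dist x (f m) + dist (f m) y = dist x y" using geodesic_dist_add[OF k] by simp
  moreover have "dist x (f m) = a - m" "dist (f m) y = a - m"
    using geodesic_final_segment[OF f, of m] geodesic_final_segment[OF h, of m] m x y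
    by (auto simp: dist_commute)
  ultimately show ?thesis using that m by simp
qed

text \<open>The geodesics to \<open>x\<close> and \<open>y\<close> agree up to \<open>m\<close>,
  those to \<open>y\<close> and \<open>z\<close> up to \<open>n\<close>, so all three agree up to
  \<open>l = min m n\<close>. Going from \<open>x\<close> to \<open>z\<close> through the point at
  height \<open>l\<close> costs \<open>2 * (a - l)\<close>, the larger of the other two
  distances.\<close>

lemma real_tree_level_set_ultrametric:
  fixes \<rho> :: "'a::real_tree"
  assumes "dist \<rho> x = a" "dist \<rho> y = a" "dist \<rho> z = a"
  shows "dist x z \<le> max (dist x y) (dist y z)"
proof -
  obtain f h k where g: "geodesic f \<rho> x" "geodesic h \<rho> y" "geodesic k \<rho> z"
    using unique_geodesic[of \<rho> x] unique_geodesic[of \<rho> y] unique_geodesic[of \<rho> z] by blast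
  obtain m where m: "0 \<le> m" "m \<le> a" "f m = h m" "dist x y = 2 * (a - m)"
    using real_tree_branch_height[OF g(1,2)] assms by metis
  obtain n where n: "0 \<le> n" "n \<le> a" "h n = k n" "dist y z = 2 * (a - n)"
    using real_tree_branch_height[OF g(2,3)] assms by metis
  define l where "l = min m n"
  have l: "0 \<le> l" "l \<le> a" using m n by (auto simp: l_def)
  have "f l = h l" "h l = k l"
    using geodesics_agree_below[OF g(1,2) _ _ m(3), of l] geodesics_agree_below[OF g(2,3) _ _ n(3), of l]
      m n l assms by (simp_all add: l_def)
  then have "dist x z \<le> dist x (f l) + dist (k l) z" by (metis dist_triangle)
  also have "dist x (f l) = a - l"
    using geodesic_final_segment[OF g(1), of l] l assms(1) by (simp add: dist_commute)
  also have "dist (k l) z = a - l"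
    using geodesic_final_segment[OF g(3), of l] l assms(3) by (simp add: dist_commute)
  finally show ?thesis using m n by (auto simp: l_def min_def max_def split: if_splits)
qed

section \<open>Disjoint covers by ultrametric balls\<close>

definition ultrametric_on :: "'a::metric_space set \<Rightarrow> bool" where
  "ultrametric_on L \<longleftrightarrow> (\<forall>x\<in>L. \<forall>y\<in>L. \<forall>z\<in>L. dist x z \<le> max (dist x y) (dist y z))"

lemma ultrametric_on_ball_eq:
  assumes L: "ultrametric_on L" and "x \<in> L" "y \<in> L" "dist x y < r"
  shows "ball x r \<inter> L = ball y r \<inter> L"
proof -
  have "ball u r \<inter> L \<subseteq> ball v r \<inter> L" if uv: "u \<in> L" "v \<in> L" "dist u v < r" for u v
  proof
    fix z assume z: "z \<in> ball u r \<inter> L"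
    then have "dist v z \<le> max (dist v u) (dist u z)" using L uv unfolding ultrametric_on_def by blast
    also have "\<dots> < r" using z uv by (simp add: dist_commute)
    finally show "z \<in> ball v r \<inter> L" using z by simp
  qed
  from this[of x y] this[of y x] show ?thesis using assms(2-4) by (auto simp: dist_commute)
qed

text \<open>The strong inequality through the centre gives \<open>r\<close> instead of
  \<open>2 * r\<close>; this is why the constant \<open>c\<close> survives exactly.\<close>

lemma ultrametric_on_diameter_ball:
  assumes L: "ultrametric_on L" and x: "x \<in> L" and r: "0 < r"
  shows "diameter (ball x r \<inter> L) \<le> r"
proof -
  have "dist y z \<le> r" if "y \<in> ball x r \<inter> L" "z \<in> ball x r \<inter> L" for y z
  proof -
    have "dist y z \<le> max (dist y x) (dist x z)" using L x that unfolding ultrametric_on_def by blast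
    also have "\<dots> \<le> r" using that by (simp add: dist_commute)
    finally show ?thesis .
  qed
  moreover have "x \<in> ball x r \<inter> L" using x r by simp
  ultimately show ?thesis unfolding diameter_def by (auto intro!: cSUP_least)
qed

text \<open>For each point of \<open>A\<close> take the largest admissible radius; it exists because \<open>g\<close> is
  continuous. In an ultrametric space an admissible ball is admissible for each of its points in
  \<open>A\<close>, so two such maximal balls that meet coincide, and \<open>A\<close> is covered by disjoint balls.\<close>

lemma hausdorff_pre_le_of_ultrametric:
  fixes L :: "'a::metric_space set" and M :: "'a measure" and g :: "real \<Rightarrow> real"
  assumes L: "compact L" "ultrametric_on L"
    and M: "finite_measure M" "sets M = sets borel"
    and g: "mono_on {0..<r0} g" "continuous_on {0..<r0} g" "g 0 = 0"
    and U: "open U" "A \<subseteq> U" and A: "A \<subseteq> L" and c: "0 < c" and r0: "0 < r0" and \<epsilon>: "0 < \<epsilon>"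
    and dens: "\<And>x \<delta>. x \<in> A \<Longrightarrow> 0 < \<delta> \<Longrightarrow> \<exists>r>0. r < \<delta> \<and> c * g r \<le> measure M (ball x r \<inter> L)"
  shows "ennreal c * hausdorff_pre g \<epsilon> A \<le> emeasure M U"
proof -
  interpret finite_measure M by fact
  \<comment> \<open>Radii up to \<open>e\<close> keep diameters strictly below \<epsilon> and stay
    where \<open>g\<close> is monotone and continuous.\<close>
  define e where "e = min \<epsilon> r0 / 2"
  have e: "0 < e" "e < \<epsilon>" "e < r0" using r0 \<epsilon> by (auto simp: e_def min_def)
  have mball [simp]: "ball x r \<inter> L \<in> sets M" for x r
    unfolding M using compact_imp_closed[OF L(1)] by auto
  \<comment> \<open>The admissible radii at \<open>x\<close>. Inclusion in \<open>U\<close> ensures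
    that the disjoint balls together have mass at most that of \<open>U\<close>.\<close>
  define S where "S x = {r. 0 < r \<and> r \<le> e \<and> ball x r \<inter> L \<subseteq> U \<and> c * g r \<le> measure M (ball x r \<inter> L)}" for x
  define R where "R x = Sup (S x)" for x
  have bdd: "bdd_above (S x)" for x by (rule bdd_aboveI[of _ e]) (auto simp: S_def)
  have RS: "R x \<in> S x" if x: "x \<in> A" for x
  proof -
    obtain \<delta> where \<delta>: "\<delta> > 0" "ball x \<delta> \<subseteq> U" using U x by (meson openE subsetD)
    then obtain r where r: "r > 0" "r < min \<delta> e" "c * g r \<le> measure M (ball x r \<inter> L)"
      using dens[OF x, of "min \<delta> e"] e by auto
    moreover have "ball x r \<subseteq> ball x \<delta>" using r by auto
    ultimately have rS: "r \<in> S x" using \<delta> by (auto simp: S_def)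
    then have ne: "S x \<noteq> {}" by auto
    have "0 < R x" using cSup_upper[OF rS bdd] r(1) by (simp add: R_def)
    moreover have Re: "R x \<le> e" unfolding R_def by (rule cSup_least[OF ne]) (auto simp: S_def)
    moreover have "ball x (R x) \<inter> L \<subseteq> U"
    proof
      \<comment> \<open>The open ball of radius \<open>R x\<close> is the union of the balls of
        smaller admissible radii.\<close>
      fix y assume y: "y \<in> ball x (R x) \<inter> L"
      then obtain s where "s \<in> S x" "dist x y < s" using less_cSup_iff[OF ne bdd] by (auto simp: R_def)
      then show "y \<in> U" using y by (auto simp: S_def)
    qed
    moreover have "c * g (R x) \<le> measure M (ball x (R x) \<inter> L)"
    proof -
      \<comment> \<open>Only the side with \<open>g\<close> passes to the limit: along admissible
        \<open>s n\<close> tending to \<open>R x\<close>, each smaller ball has mass at most that of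
        the ball of radius \<open>R x\<close>.\<close>
      have "R x \<in> closure (S x)" unfolding R_def by (rule closure_contains_Sup[OF ne bdd])
      then obtain s where s: "\<And>n. s n \<in> S x" "s \<longlonglongrightarrow> R x" unfolding closure_sequential by blast
      have "(\<lambda>n. g (s n)) \<longlonglongrightarrow> g (R x)"
        by (rule continuous_on_tendsto_compose[OF g(2) s(2)])
           (use s(1) \<open>0 < R x\<close> Re e in \<open>auto simp: S_def intro!: always_eventually less_imp_le intro: le_less_trans\<close>)
      then have "(\<lambda>n. c * g (s n)) \<longlonglongrightarrow> c * g (R x)" by (rule tendsto_mult_left)
      moreover have "c * g (s n) \<le> measure M (ball x (R x) \<inter> L)" for n
      proof -
        have "s n \<le> R x" unfolding R_def by (rule cSup_upper[OF s(1) bdd])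
        then have "ball x (s n) \<inter> L \<subseteq> ball x (R x) \<inter> L" by auto
        then have "measure M (ball x (s n) \<inter> L) \<le> measure M (ball x (R x) \<inter> L)"
          by (rule finite_measure_mono) simp
        then show ?thesis using s(1)[of n] by (simp add: S_def)
      qed
      ultimately show ?thesis by (auto intro: LIMSEQ_le_const2)
    qed
    ultimately show ?thesis by (simp add: S_def)
  qed
  have R: "0 < R x" "R x \<le> e" "ball x (R x) \<inter> L \<subseteq> U"
      "c * g (R x) \<le> measure M (ball x (R x) \<inter> L)" if "x \<in> A" for x
    using RS[OF that] by (auto simp: S_def)
  define D where "D = (\<lambda>x. ball x (R x) \<inter> L) ` A"
  have eqD: "ball x (R x) \<inter> L = ball y (R y) \<inter> L"
    if xy: "x \<in> A" "y \<in> A" "R y \<le> R x" and z: "z \<in> ball x (R x) \<inter> L" "z \<in> ball y (R y) \<inter> L" for x y z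
  proof -
    have "dist x y \<le> max (dist x z) (dist z y)" using L(2) xy z A unfolding ultrametric_on_def by blast
    also have "\<dots> < R x" using xy z by (auto simp: dist_commute)
    \<comment> \<open>The larger ball can be recentred at \<open>y\<close> without changing as a
      set, so its radius is admissible at \<open>y\<close>; maximality of \<open>R y\<close> then
      forces equal radii.\<close>
    finally have eq: "ball x (R x) \<inter> L = ball y (R x) \<inter> L"
      using ultrametric_on_ball_eq[OF L(2)] xy A by blast
    then have "R x \<in> S y" using RS[OF xy(1)] by (simp add: S_def)
    then have "R x \<le> R y" unfolding R_def[of y] by (rule cSup_upper[OF _ bdd])
    then show ?thesis using eq xy by simp
  qed
  have disjD: "disjoint D"
  proof (rule disjointI)
    fix X Y assume XY: "X \<in> D" "Y \<in> D" "X \<noteq> Y"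
    then obtain x y where xy: "x \<in> A" "y \<in> A" "X = ball x (R x) \<inter> L" "Y = ball y (R y) \<inter> L"
      by (auto simp: D_def)
    show "X \<inter> Y = {}"
    proof (rule ccontr)
      assume "X \<inter> Y \<noteq> {}"
      then obtain z where "z \<in> X" "z \<in> Y" by auto
      then have "X = Y" using eqD[of x y z] eqD[of y x z] xy by (cases "R y \<le> R x") auto
      then show False using XY by simp
    qed
  qed
  have cD: "countable D"
    unfolding D_def by (rule countable_disjoint_balls_compact[OF L(1) A R(1)]) (use disjD D_def in auto)
  have D: "X \<in> sets M" "X \<subseteq> U" "bounded X" "diameter X \<le> e"
      "ennreal c * ennreal (g (diameter X)) \<le> emeasure M X" if "X \<in> D" for X
  proof -
    from that obtain x where x: "x \<in> A" "X = ball x (R x) \<inter> L" by (auto simp: D_def)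
    show "X \<in> sets M" "X \<subseteq> U" using R[OF x(1)] x(2) by auto
    show bX: "bounded X" unfolding x(2) by (simp add: bounded_Int)
    have d: "diameter X \<le> R x"
      unfolding x(2) by (rule ultrametric_on_diameter_ball[OF L(2)]) (use x A R in auto)
    then show "diameter X \<le> e" using R[OF x(1)] by simp
    have "g (diameter X) \<le> g (R x)"
      by (rule mono_onD[OF g(1)]) (use d R[OF x(1)] e diameter_ge_0[OF bX] in auto)
    then have "c * g (diameter X) \<le> c * g (R x)" using c by simp
    also have "\<dots> \<le> measure M X" using R(4)[OF x(1)] x(2) by simp
    finally show "ennreal c * ennreal (g (diameter X)) \<le> emeasure M X"
      using c by (simp add: emeasure_eq_measure ennreal_mult'[symmetric] ennreal_leI)
  qed
  \<comment> \<open>Outside the codes of \<open>D\<close>, \<open>from_nat_into\<close> returns a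
    default member, which would repeat a ball. Empty sets there keep the family disjoint, cost
    nothing since \<open>g 0 = 0\<close>, and cover the case of finite or empty
    \<open>D\<close>.\<close>
  define E where "E n = (if n \<in> to_nat_on D ` D then from_nat_into D n else {})" for n
  have E_cases: "E n \<in> D \<or> E n = {}" for n using cD by (auto simp: E_def)
  have E_bounds: "bounded (E n)" "diameter (E n) \<le> e" "E n \<in> sets M" "E n \<subseteq> U"
      "ennreal c * ennreal (g (diameter (E n))) \<le> emeasure M (E n)" for n
    using E_cases[of n] D e g(3) by auto
  have UnE: "A \<subseteq> (\<Union>n. E n)"
  proof
    fix x assume x: "x \<in> A"
    then have XD: "ball x (R x) \<inter> L \<in> D" by (simp add: D_def)
    then have "E (to_nat_on D (ball x (R x) \<inter> L)) = ball x (R x) \<inter> L" using cD by (simp add: E_def)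
    moreover have "x \<in> ball x (R x) \<inter> L" using x A R by auto
    ultimately show "x \<in> (\<Union>n. E n)" by blast
  qed
  have disjE: "disjoint_family E"
    unfolding disjoint_family_on_def
  proof (intro ballI impI)
    fix m n :: nat assume "m \<noteq> n"
    show "E m \<inter> E n = {}"
    proof (cases "m \<in> to_nat_on D ` D \<and> n \<in> to_nat_on D ` D")
      case True
      then obtain X Y where XY: "X \<in> D" "Y \<in> D" "m = to_nat_on D X" "n = to_nat_on D Y" by auto
      then have "E m = X" "E n = Y" using cD by (auto simp: E_def)
      moreover have "X \<noteq> Y" using XY \<open>m \<noteq> n\<close> by auto
      ultimately show ?thesis using disjD XY disjointD by blast
    qed (auto simp: E_def)
  qed
  have "hausdorff_pre g \<epsilon> A \<le> (\<Sum>n. ennreal (g (diameter (E n))))"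
    unfolding hausdorff_pre_def
    by (rule INF_lower) (use UnE E_bounds e in \<open>auto intro: le_less_trans\<close>)
  then have "ennreal c * hausdorff_pre g \<epsilon> A \<le> ennreal c * (\<Sum>n. ennreal (g (diameter (E n))))"
    by (rule mult_left_mono) simp
  also have "\<dots> = (\<Sum>n. ennreal c * ennreal (g (diameter (E n))))" by simp
  also have "\<dots> \<le> (\<Sum>n. emeasure M (E n))" by (intro suminf_le E_bounds summableI)
  also have "\<dots> = emeasure M (\<Union>n. E n)"
    by (rule suminf_emeasure) (use E_bounds disjE in auto)
  also have "\<dots> \<le> emeasure M U" by (rule emeasure_mono) (use E_bounds(4) U M in \<open>auto intro!: UN_least\<close>)
  finally show ?thesis .
qed

section \<open>From the upper density to the measure inequality\<close>

lemma frequently_of_Limsup_gt: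
  fixes f :: "'a \<Rightarrow> 'b::complete_linorder"
  shows "C < Limsup F f \<Longrightarrow> \<exists>\<^sub>F x in F. C < f x"
  unfolding frequently_def using Limsup_bounded[of f C F] by (auto simp: not_less)

theorem lemma3:
  fixes \<rho> :: "'a::real_tree"
    and \<mu> :: "'a measure"
    and A :: "'a set"
    and g :: "real \<Rightarrow> real"
    and r0 a c :: real
  assumes "0 < r0"
    and "\<And>r. r \<in> {0..<r0} \<Longrightarrow> 0 \<le> g r"
    and "mono_on {0..<r0} g"
    and "continuous_on {0..<r0} g"
    and "g 0 = 0"
    and "compact (UNIV :: 'a set)"
    and "0 < a"
    and "level_set \<rho> a \<noteq> {}"
    and "sets \<mu> = sets borel"
    and "finite_measure \<mu>"
    and "emeasure \<mu> (UNIV - level_set \<rho> a) = 0"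
    and "A \<in> sets borel"
    and "A \<subseteq> level_set \<rho> a"
    and "0 < c"
    and "\<And>\<sigma>. \<sigma> \<in> A \<Longrightarrow>
           Limsup (at_right 0) (\<lambda>r. emeasure \<mu> (ball \<sigma> r) / ennreal (g r)) > ennreal c"
  shows "emeasure \<mu> A \<ge> ennreal c * hausdorff_measure g A"
proof -
  interpret finite_measure \<mu> by fact
  note sets = assms(9)
  have closed_L: "closed (level_set \<rho> a)"
    by (intro closed_Collect_eq continuous_intros)
  have compact_L: "compact (level_set \<rho> a)"
    using compact_Int_closed[OF assms(6) closed_L] by simp
  have ultra: "ultrametric_on (level_set \<rho> a)"
    unfolding ultrametric_on_def using real_tree_level_set_ultrametric by blast
  have ball_L: "emeasure \<mu> (ball x r) = emeasure \<mu> (ball x r \<inter> level_set \<rho> a)" for x r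
  proof (rule emeasure_eq_AE)
    have "UNIV - level_set \<rho> a \<in> null_sets \<mu>"
      using assms(11) closed_L sets by (auto simp: null_sets_def Collect_neg_eq[symmetric])
    then have "AE y in \<mu>. y \<notin> UNIV - level_set \<rho> a" by (rule AE_not_in)
    then show "AE y in \<mu>. y \<in> ball x r \<longleftrightarrow> y \<in> ball x r \<inter> level_set \<rho> a" by eventually_elim auto
  qed (use closed_L sets in auto)
  have dens: "\<exists>r>0. r < \<delta> \<and> c * g r \<le> measure \<mu> (ball x r \<inter> level_set \<rho> a)"
    if "x \<in> A" "0 < \<delta>" for x \<delta>
  proof -
    have "\<exists>\<^sub>F r in at_right 0. ennreal c < emeasure \<mu> (ball x r) / ennreal (g r)"
      by (rule frequently_of_Limsup_gt) (rule assms(15)[OF that(1)])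
    \<comment> \<open>The bound \<open>r0\<close> puts \<open>r\<close> in the domain of
      \<open>g\<close>, where \<open>g r\<close> is nonnegative.\<close>
    moreover have "\<forall>\<^sub>F r in at_right 0. r < min \<delta> r0 \<and> 0 < r"
      using that assms(1) eventually_at_right_real[of 0 "min \<delta> r0"] by (auto elim: eventually_mono)
    ultimately obtain r where r: "0 < r" "r < \<delta>" "r < r0"
        "ennreal c < emeasure \<mu> (ball x r) / ennreal (g r)"
      using frequently_eventually_frequently frequently_ex by force
    have "c * g r \<le> measure \<mu> (ball x r)"
    \<comment> \<open>If \<open>g r = 0\<close>, the claim is just nonnegativity of a measure.
      Otherwise the extended quotient is an ordinary real one, because \<mu> is finite.\<close>
    proof (cases "g r = 0")
      case False
      then have "0 < g r" using assms(2)[of r] r by fastforce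
      then have "ennreal c < ennreal (measure \<mu> (ball x r) / g r)"
        using r(4) by (simp add: emeasure_eq_measure divide_ennreal)
      then have "c < measure \<mu> (ball x r) / g r" using assms(14) by (simp add: ennreal_less_iff)
      then show ?thesis using \<open>0 < g r\<close> by (simp add: pos_less_divide_eq)
    qed simp
    then show ?thesis using r ball_L[of x r] by (auto simp: measure_def)
  qed
  have "ennreal c * hausdorff_pre g \<epsilon> A \<le> emeasure \<mu> A" if "0 < \<epsilon>" for \<epsilon>
  proof (rule ennreal_le_epsilon)
    fix \<eta> :: real assume "0 < \<eta>"
    then obtain U where U: "open U" "A \<subseteq> U" "measure \<mu> U < measure \<mu> A + \<eta>"
      using outer_regular_metric[OF assms(10,9,12)] by blast
    have "ennreal c * hausdorff_pre g \<epsilon> A \<le> emeasure \<mu> U"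
      by (rule hausdorff_pre_le_of_ultrametric[OF compact_L ultra assms(10,9,3,4,5) U(1,2)
            assms(13,14,1) that dens])
    also have "\<dots> \<le> ennreal (measure \<mu> A + \<eta>)" using U(3) by (simp add: emeasure_eq_measure ennreal_leI)
    also have "\<dots> = emeasure \<mu> A + ennreal \<eta>" using \<open>0 < \<eta>\<close> by (simp add: emeasure_eq_measure)
    finally show "ennreal c * hausdorff_pre g \<epsilon> A \<le> emeasure \<mu> A + ennreal \<eta>" .
  qed
  \<comment> \<open>The bound does not depend on \<epsilon>, so it passes to the supremum over
    \<epsilon>, which is the Hausdorff measure.\<close>
  then show ?thesis
    unfolding hausdorff_measure_eq_SUP by (subst SUP_mult_left_ennreal) (auto intro!: SUP_least)
qed

end
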